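(* The function $$V(x,m)\equiv\sup_{\tau\in\mathcal T_{X,M}}\mathbf E_{x,m}\left[[1-F(M_\tau)]\,e^{-r\tau}R(X_\tau)+\int_0^\tau e^{-rt}G(M_t)f(M_t)\,dM_t\right],\quad (x,m)\in\mathcal I\times\mathcal I,\ m\ge x,$$ is well-defined (for each $\tau$ the random variable inside the expectation is $\mathbf P_{x,m}$-integrable), and $$\overline V(x)=V(x,x)+F(x)G(x)$$ for all $x\in\mathcal I$, where $$\overline V(x)\equiv\sup_{\tau\in\mathcal T_X}\overline{\mathbf E}_x\left[1_{\{\tau<\tau_{X\ge Y}\}}e^{-r\tau}R(X_\tau)+1_{\{\tau\ge\tau_{X\ge Y}\}}e^{-r\tau_{X\ge Y}}G(X_{\tau_{X\ge Y}})\right].$$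
   Context: Setting. $r>0$ is a discount rate and $\mathcal I=(\alpha,\beta)$, $-\infty\le\alpha<\beta\le\infty$. $X=(X_t)_{t\ge0}$ is a time-homogeneous diffusion on the canonical space $(\Omega,\mathcal F,\mathbf P_x)$ of continuous trajectories, with $X_0=x\in\mathcal I$ under $\mathbf P_x$, which is the (unique in law) weak solution of $dX_t=\mu(X_t)\,dt+\sigma(X_t)\,dW_t$ ($W$ a Brownian motion), with state space $\mathcal I$; $\mu,\sigma$ are continuous with $\sigma>0$ on $\mathcal I$, and $\alpha,\beta$ are natural (inaccessible) endpoints. $\mathbf E_x$ is expectation under $\mathbf P_x$. $\mathcal T_X$ is the set of stopping times (values in $[0,\infty]$) of the right-continuous filtration generated by $X$. Convention: $g(X_\tau)\equiv0$ on $\{\tau=\infty\}$ for any Borel $g$ and random time $\tau$; $\inf\emptyset=\infty$. $\mathcal L u(x)=\mu(x)u'(x)+\frac12\sigma^2(x)u''(x)$. Assumptions on $R$: $R\in\mathcal C^2(\mathcal I)$; (A1) $\mathbf E_x[\sup_{t\ge0}e^{-rt}|R(X_t)|]<\infty$ for all $x$; (A2) $\lim_{t\to\infty}e^{-rt}R(X_t)=0$ $\mathbf P_x$-a.s. for all $x$; (A3) there is $x_0\in\mathcal I$ with $\mathcal L R-rR>0$ on $(\alpha,x_0)$ and $\mathcal LR-rR<0$ on $(x_0,\beta)$. Let $V_R(x)\equiv\sup_{\tau\in\mathcal T_X}\mathbf E_x[e^{-r\tau}R(X_\tau)]$. It is part of the setting that the stopping region $\{V_R=R\}$ is $[x_R,\beta)$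 for some $x_R\in(x_0,\beta)$. Assumptions on $G$: $G\in\mathcal C^1(\mathcal I)$, piecewise $\mathcal C^2$; (A4) $\mathbf E_x[\sup_{t\ge0}e^{-rt}G(X_t)]<\infty$ for all $x$; (A5) $\lim_{t\to\infty}e^{-rt}G(X_t)=0$ $\mathbf P_x$-a.s. for all $x$; (A6) $G>V_R$ on $\mathcal I$; (A7) $\mathcal LG-rG\le0$ wherever $G''$ is defined. $Y$ is an $\mathcal I$-valued random variable independent of $X$, with law $\mathbf Q$ and cumulative distribution function $F$; (A8) $\mathbf Q$ has a locally Lipschitz density $f>0$ on $\mathcal I$ with respect to Lebesgue measure. $\overline{\mathbf E}_x$ is expectation under $\overline{\mathbf P}_x=\mathbf P_x\otimes\mathbf Q$ on the product space $\Omega\times\mathcal I$; elements of $\mathcal T_X$ are viewed as functions on $\Omega\times\mathcal I$ not depending on $Y$. $\tau_{X\ge Y}\equiv\inf\{t\ge0:X_t\ge Y\}$. Maximum process: for $x,m\in\mathcal I$ with $m\ge x$, $M_t\equiv m\vee\sup_{s\le t}X_s$ under $\mathbf P_{x,m}$, the law of the Markov process $(X,M)$ started at $(x,m)$; $\mathbf E_{x,m}$ is the expectation and $\mathcal T_{X,M}$ the set of stopping times of the right-continuous filtration generated by $(X,M)$. *)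

theory Defs
  imports "HOL-Probability.Probability"
begin

section \<open>Filtrations and stopping times\<close>

text \<open>Times range over \<open>[0, \<infinity>]\<close>, i.e. over \<^typ>\<open>ennreal\<close>; processes are
  indexed by the nonnegative reals and their values at negative indices are never used.\<close>

definition generated_filtration ::
  "'w set \<Rightarrow> (real \<Rightarrow> 'w \<Rightarrow> 'b::topological_space) \<Rightarrow> ennreal \<Rightarrow> 'w measure"
where
  "generated_filtration \<Omega> Z t =
     sigma \<Omega> {Z s -` B \<inter> \<Omega> |s B. 0 \<le> s \<and> ennreal s \<le> t \<and> B \<in> sets borel}"

text \<open>The index \<open>u = \<infinity>\<close> belongs to every intersection, which only matters at \<open>t = \<infinity>\<close>,
  where no \<open>u > t\<close> exists.\<close>

definition right_cont_filtration ::
  "'w set \<Rightarrow> (real \<Rightarrow> 'w \<Rightarrow> 'b::topological_space) \<Rightarrow> ennreal \<Rightarrow> 'w measure"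
where
  "right_cont_filtration \<Omega> Z t =
     sigma \<Omega> (\<Inter>u\<in>{u. t < u \<or> u = \<infinity>}. sets (generated_filtration \<Omega> Z u))"


section \<open>Brownian motion, Ito integral and weak solutions\<close>

definition brownian_motion ::
  "'w measure \<Rightarrow> (ennreal \<Rightarrow> 'w measure) \<Rightarrow> (real \<Rightarrow> 'w \<Rightarrow> real) \<Rightarrow> bool"
where
  "brownian_motion N \<FF> W \<longleftrightarrow>
     (\<forall>t\<ge>0. W t \<in> borel_measurable (\<FF> (ennreal t))) \<and>
     (\<forall>\<omega>\<in>space N. continuous_on {0..} (\<lambda>t. W t \<omega>)) \<and>
     (AE \<omega> in N. W 0 \<omega> = 0) \<and>
     (\<forall>s t. 0 \<le> s \<and> s < t \<longrightarrow>
        distributed N lborel (\<lambda>\<omega>. W t \<omega> - W s \<omega>)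
          (\<lambda>z. ennreal (normal_density 0 (sqrt (t - s)) z)) \<and>
        prob_space.indep_set N (sets (\<FF> (ennreal s)))
          (sets (vimage_algebra (space N) (\<lambda>\<omega>. W t \<omega> - W s \<omega>) borel)))"

text \<open>A simple integrand is \<open>\<Sum>i<k. \<xi>\<^sub>i 1\<^bsub>(\<theta>\<^sub>i, \<theta>\<^sub>i\<^sub>+\<^sub>1]\<^esub>\<close>, where \<open>\<xi>\<^sub>i\<close> is bounded and known at
  time \<open>\<theta>\<^sub>i\<close>.\<close>

definition simple_integrand ::
  "'w measure \<Rightarrow> (ennreal \<Rightarrow> 'w measure) \<Rightarrow> nat \<Rightarrow> (nat \<Rightarrow> real) \<Rightarrow> (nat \<Rightarrow> 'w \<Rightarrow> real) \<Rightarrow> bool"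
where
  "simple_integrand N \<FF> k \<theta> \<xi> \<longleftrightarrow>
     0 \<le> \<theta> 0 \<and> (\<forall>i<k. \<theta> i \<le> \<theta> (Suc i)) \<and>
     (\<forall>i<k. \<xi> i \<in> borel_measurable (\<FF> (ennreal (\<theta> i))) \<and> (\<exists>C. \<forall>\<omega>\<in>space N. \<bar>\<xi> i \<omega>\<bar> \<le> C))"

definition simple_process ::
  "nat \<Rightarrow> (nat \<Rightarrow> real) \<Rightarrow> (nat \<Rightarrow> 'w \<Rightarrow> real) \<Rightarrow> real \<Rightarrow> 'w \<Rightarrow> real"
where
  "simple_process k \<theta> \<xi> t \<omega> = (\<Sum>i<k. \<xi> i \<omega> * indicator {\<theta> i<..\<theta> (Suc i)} t)"

definition simple_stoch_integral ::
  "(real \<Rightarrow> 'w \<Rightarrow> real) \<Rightarrow> nat \<Rightarrow> (nat \<Rightarrow> real) \<Rightarrow> (nat \<Rightarrow> 'w \<Rightarrow> real) \<Rightarrow> real \<Rightarrow> 'w \<Rightarrow> real"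
where
  "simple_stoch_integral W k \<theta> \<xi> t \<omega> =
     (\<Sum>i<k. \<xi> i \<omega> * (W (min (\<theta> (Suc i)) t) \<omega> - W (min (\<theta> i) t) \<omega>))"

text \<open>\<open>is_ito_integral N \<FF> W H J\<close> says that \<open>J\<^sub>t = \<integral>\<^sub>0\<^sup>t H\<^sub>s dW\<^sub>s\<close> for all \<open>t \<ge> 0\<close>, up to
  indistinguishability: \<open>J\<close> is the limit, in probability and uniformly on compact time sets, of
  integrals of simple integrands \<open>H\<^sup>n\<close> with \<open>\<integral>\<^sub>0\<^sup>T (H\<^sup>n - H)\<^sup>2 dt \<rightarrow> 0\<close> in probability for all \<open>T\<close>.
  It is used for path-continuous \<open>W\<close>, \<open>H\<close> and \<open>J\<close> only, so the events below are measurable.\<close>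

definition is_ito_integral ::
  "'w measure \<Rightarrow> (ennreal \<Rightarrow> 'w measure) \<Rightarrow> (real \<Rightarrow> 'w \<Rightarrow> real) \<Rightarrow>
   (real \<Rightarrow> 'w \<Rightarrow> real) \<Rightarrow> (real \<Rightarrow> 'w \<Rightarrow> real) \<Rightarrow> bool"
where
  "is_ito_integral N \<FF> W H J \<longleftrightarrow>
     (\<exists>k \<theta> \<xi>. (\<forall>n. simple_integrand N \<FF> (k n) (\<theta> n) (\<xi> n)) \<and>
        (\<forall>T\<ge>0. \<forall>\<epsilon>>0.
           (\<lambda>n. measure N {\<omega>\<in>space N.
              \<epsilon> < (LBINT t:{0..T}. (simple_process (k n) (\<theta> n) (\<xi> n) t \<omega> - H t \<omega>)\<^sup>2)}) \<longlonglongrightarrow> 0 \<and>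
           (\<lambda>n. measure N {\<omega>\<in>space N.
              \<exists>t\<in>{0..T}. \<epsilon> < \<bar>simple_stoch_integral W (k n) (\<theta> n) (\<xi> n) t \<omega> - J t \<omega>\<bar>}) \<longlonglongrightarrow> 0))"

text \<open>A weak solution \<open>(Z, W)\<close> of \<open>dZ\<^sub>t = \<mu>(Z\<^sub>t) dt + \<sigma>(Z\<^sub>t) dW\<^sub>t\<close>, \<open>Z\<^sub>0 = x\<close>, that lives in \<open>I\<close>.\<close>

definition weak_solution ::
  "real set \<Rightarrow> (real \<Rightarrow> real) \<Rightarrow> (real \<Rightarrow> real) \<Rightarrow> real \<Rightarrow>
   'w measure \<Rightarrow> (ennreal \<Rightarrow> 'w measure) \<Rightarrow> (real \<Rightarrow> 'w \<Rightarrow> real) \<Rightarrow> (real \<Rightarrow> 'w \<Rightarrow> real) \<Rightarrow> bool"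
where
  "weak_solution I \<mu> \<sigma> x N \<FF> Z W \<longleftrightarrow>
     prob_space N \<and> filtration (space N) \<FF> \<and> (\<forall>t. subalgebra N (\<FF> t)) \<and>
     brownian_motion N \<FF> W \<and>
     (\<forall>t\<ge>0. Z t \<in> borel_measurable (\<FF> (ennreal t))) \<and>
     (\<forall>\<omega>\<in>space N. continuous_on {0..} (\<lambda>t. Z t \<omega>) \<and> (\<forall>t\<ge>0. Z t \<omega> \<in> I)) \<and>
     (AE \<omega> in N. Z 0 \<omega> = x) \<and>
     is_ito_integral N \<FF> W (\<lambda>t \<omega>. \<sigma> (Z t \<omega>))
       (\<lambda>t \<omega>. Z t \<omega> - x - (LBINT s:{0..t}. \<mu> (Z s \<omega>)))"


section \<open>The diffusion on the canonical space\<close>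

definition paths :: "real set \<Rightarrow> (real \<Rightarrow> real) set" where
  "paths I = {\<omega> \<in> {0..} \<rightarrow>\<^sub>E I. continuous_on {0..} \<omega>}"

definition path_space :: "real set \<Rightarrow> (real \<Rightarrow> real) measure" where
  "path_space I = generated_filtration (paths I) (\<lambda>t \<omega>. \<omega> t) \<infinity>"

text \<open>\<open>P\<close> is the law on the canonical space of a weak solution started at \<open>x\<close>, and it is the only
  such law. HOL cannot quantify over all probability spaces; taking the sample points to be pairs
  of functions loses nothing, because a weak solution \<open>(Z, W)\<close> on any space can be transported to
  the space of pairs of paths, equipped with the joint law of \<open>(Z, W)\<close> and the filtration generated
  by the coordinates.\<close>

definition diffusion_law ::
  "real set \<Rightarrow> (real \<Rightarrow> real) \<Rightarrow> (real \<Rightarrow> real) \<Rightarrow> real \<Rightarrow> (real \<Rightarrow> real) measure \<Rightarrow> bool"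
where
  "diffusion_law I \<mu> \<sigma> x P \<longleftrightarrow>
     (\<exists>(N :: ((real \<Rightarrow> real) \<times> (real \<Rightarrow> real)) measure) \<FF> Z W.
        weak_solution I \<mu> \<sigma> x N \<FF> Z W \<and>
        P = distr N (path_space I) (\<lambda>\<omega>. \<lambda>t\<in>{0..}. Z t \<omega>)) \<and>
     (\<forall>(N :: ((real \<Rightarrow> real) \<times> (real \<Rightarrow> real)) measure) \<FF> Z W.
        weak_solution I \<mu> \<sigma> x N \<FF> Z W \<longrightarrow>
        P = distr N (path_space I) (\<lambda>\<omega>. \<lambda>t\<in>{0..}. Z t \<omega>))"

definition scale_density :: "(real \<Rightarrow> real) \<Rightarrow> (real \<Rightarrow> real) \<Rightarrow> real \<Rightarrow> real \<Rightarrow> real" where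
  "scale_density \<mu> \<sigma> c y = exp (- (LBINT z=ereal c..ereal y. 2 * \<mu> z / (\<sigma> z)\<^sup>2))"

definition speed_density :: "(real \<Rightarrow> real) \<Rightarrow> (real \<Rightarrow> real) \<Rightarrow> real \<Rightarrow> real \<Rightarrow> real" where
  "speed_density \<mu> \<sigma> c y = 2 / ((\<sigma> y)\<^sup>2 * scale_density \<mu> \<sigma> c y)"

text \<open>Feller's classification: an endpoint is natural if it is neither an exit (the first integral,
  \<open>\<integral> s(y) m([y, c]) dy\<close>, diverges) nor an entrance boundary (the second integral, with the scale
  density \<open>s\<close> and the speed density \<open>m\<close> exchanged, diverges). This does not depend on the reference
  point \<open>c\<close>.\<close>

definition natural_left :: "real set \<Rightarrow> (real \<Rightarrow> real) \<Rightarrow> (real \<Rightarrow> real) \<Rightarrow> bool" where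
  "natural_left I \<mu> \<sigma> \<longleftrightarrow> (\<forall>c\<in>I.
     (\<integral>\<^sup>+y\<in>{y\<in>I. y \<le> c}. (\<integral>\<^sup>+z\<in>{y..c}.
        ennreal (scale_density \<mu> \<sigma> c y * speed_density \<mu> \<sigma> c z) \<partial>lborel) \<partial>lborel) = \<infinity> \<and>
     (\<integral>\<^sup>+y\<in>{y\<in>I. y \<le> c}. (\<integral>\<^sup>+z\<in>{y..c}.
        ennreal (speed_density \<mu> \<sigma> c y * scale_density \<mu> \<sigma> c z) \<partial>lborel) \<partial>lborel) = \<infinity>)"

definition natural_right :: "real set \<Rightarrow> (real \<Rightarrow> real) \<Rightarrow> (real \<Rightarrow> real) \<Rightarrow> bool" where
  "natural_right I \<mu> \<sigma> \<longleftrightarrow> (\<forall>c\<in>I.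
     (\<integral>\<^sup>+y\<in>{y\<in>I. c \<le> y}. (\<integral>\<^sup>+z\<in>{c..y}.
        ennreal (scale_density \<mu> \<sigma> c y * speed_density \<mu> \<sigma> c z) \<partial>lborel) \<partial>lborel) = \<infinity> \<and>
     (\<integral>\<^sup>+y\<in>{y\<in>I. c \<le> y}. (\<integral>\<^sup>+z\<in>{c..y}.
        ennreal (speed_density \<mu> \<sigma> c y * scale_density \<mu> \<sigma> c z) \<partial>lborel) \<partial>lborel) = \<infinity>)"

definition generator :: "(real \<Rightarrow> real) \<Rightarrow> (real \<Rightarrow> real) \<Rightarrow> (real \<Rightarrow> real) \<Rightarrow> real \<Rightarrow> real" where
  "generator \<mu> \<sigma> u x = \<mu> x * deriv u x + 1 / 2 * (\<sigma> x)\<^sup>2 * deriv (deriv u) x"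


section \<open>Stopping problems\<close>

text \<open>Value functions are extended-real suprema, so that no junk value of \<^const>\<open>Sup\<close> on unbounded
  sets of reals can enter.\<close>

definition stopping_times_X :: "real set \<Rightarrow> ((real \<Rightarrow> real) \<Rightarrow> ennreal) set" where
  "stopping_times_X I = {\<tau>. stopping_time (right_cont_filtration (paths I) (\<lambda>t \<omega>. \<omega> t)) \<tau>}"

text \<open>\<open>e\<^sup>-\<^sup>r\<^sup>T g(X\<^sub>T)\<close>, which is \<open>0\<close> when \<open>T = \<infinity>\<close>.\<close>

definition discounted :: "real \<Rightarrow> (real \<Rightarrow> real) \<Rightarrow> (real \<Rightarrow> real) \<Rightarrow> ennreal \<Rightarrow> real" where
  "discounted r g \<omega> T =
     (if T = \<infinity> then 0 else exp (- r * enn2real T) * g (\<omega> (enn2real T)))"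

definition V_R ::
  "real set \<Rightarrow> (real \<Rightarrow> (real \<Rightarrow> real) measure) \<Rightarrow> real \<Rightarrow> (real \<Rightarrow> real) \<Rightarrow> real \<Rightarrow> ereal"
where
  "V_R I P r R x =
     (SUP \<tau>\<in>stopping_times_X I. ereal (\<integral>\<omega>. discounted r R \<omega> (\<tau> \<omega>) \<partial>P x))"

text \<open>\<open>\<tau>\<^bsub>X \<ge> Y\<^esub>\<close>; the infimum of the empty set is \<open>\<infinity>\<close> in \<^typ>\<open>ennreal\<close>.\<close>

definition hit :: "(real \<Rightarrow> real) \<Rightarrow> real \<Rightarrow> ennreal" where
  "hit \<omega> y = (INF t\<in>{t. 0 \<le> t \<and> y \<le> \<omega> t}. ennreal t)"

text \<open>The law \<open>Q\<close> of \<open>Y\<close> is a distribution on the reals that is concentrated on \<open>I\<close>;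
  its restriction to \<open>I\<close> gives the product space \<open>\<Omega> \<times> I\<close>.\<close>

definition V_bar ::
  "real set \<Rightarrow> (real \<Rightarrow> (real \<Rightarrow> real) measure) \<Rightarrow> real measure \<Rightarrow> real \<Rightarrow>
   (real \<Rightarrow> real) \<Rightarrow> (real \<Rightarrow> real) \<Rightarrow> real \<Rightarrow> ereal"
where
  "V_bar I P Q r R G x =
     (SUP \<tau>\<in>stopping_times_X I. ereal (\<integral>(\<omega>, y).
          of_bool (\<tau> \<omega> < hit \<omega> y) * discounted r R \<omega> (\<tau> \<omega>) +
          of_bool (hit \<omega> y \<le> \<tau> \<omega>) * discounted r G \<omega> (hit \<omega> y)
        \<partial>(P x \<Otimes>\<^sub>M restrict_space Q I)))"


section \<open>The maximum process\<close>

text \<open>The process \<open>(X, M)\<close> started at \<open>(x, m)\<close> is realised on the canonical space of \<open>X\<close>: under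
  \<open>P\<^sub>x\<close>, the second component is \<^term>\<open>run_max m\<close>. So the expectation under \<open>P\<^bsub>x,m\<^esub>\<close> of a functional
  of \<open>(X, M)\<close> is the expectation under \<open>P\<^sub>x\<close> of that functional of \<open>X\<close> and \<^term>\<open>run_max m\<close>.\<close>

definition run_max :: "real \<Rightarrow> (real \<Rightarrow> real) \<Rightarrow> real \<Rightarrow> real" where
  "run_max m \<omega> t = max m (SUP s\<in>{0..t}. \<omega> s)"

definition stopping_times_XM :: "real set \<Rightarrow> real \<Rightarrow> ((real \<Rightarrow> real) \<Rightarrow> ennreal) set" where
  "stopping_times_XM I m =
     {\<tau>. stopping_time (right_cont_filtration (paths I) (\<lambda>t \<omega>. (\<omega> t, run_max m \<omega> t))) \<tau>}"

text \<open>The Lebesgue-Stieltjes measure \<open>dM\<^sub>t\<close>; the path is extended to negative times as a constant,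
  so that there is no mass on \<open>(-\<infinity>, 0]\<close>.\<close>

definition dM :: "real \<Rightarrow> (real \<Rightarrow> real) \<Rightarrow> real measure" where
  "dM m \<omega> = interval_measure (\<lambda>t. run_max m \<omega> (max 0 t))"

definition XM_payoff ::
  "real measure \<Rightarrow> (real \<Rightarrow> real) \<Rightarrow> real \<Rightarrow> (real \<Rightarrow> real) \<Rightarrow> (real \<Rightarrow> real) \<Rightarrow> real \<Rightarrow>
   ((real \<Rightarrow> real) \<Rightarrow> ennreal) \<Rightarrow> (real \<Rightarrow> real) \<Rightarrow> real"
where
  "XM_payoff Q f r R G m \<tau> \<omega> =
     (1 - cdf Q (run_max m \<omega> (enn2real (\<tau> \<omega>)))) * discounted r R \<omega> (\<tau> \<omega>) +
     (LINT t:{t. 0 \<le> t \<and> ennreal t \<le> \<tau> \<omega>}|dM m \<omega>.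
        exp (- r * t) * G (run_max m \<omega> t) * f (run_max m \<omega> t))"

definition V_XM ::
  "real set \<Rightarrow> (real \<Rightarrow> (real \<Rightarrow> real) measure) \<Rightarrow> real measure \<Rightarrow> (real \<Rightarrow> real) \<Rightarrow> real \<Rightarrow>
   (real \<Rightarrow> real) \<Rightarrow> (real \<Rightarrow> real) \<Rightarrow> real \<Rightarrow> real \<Rightarrow> ereal"
where
  "V_XM I P Q f r R G x m =
     (SUP \<tau>\<in>stopping_times_XM I m. ereal (\<integral>\<omega>. XM_payoff Q f r R G m \<tau> \<omega> \<partial>P x))"

end

theory Submission
  imports Defs
begin

text \<open>For \<open>y > m \<or> X\<^sub>0\<close> the hitting time of \<open>y\<close> is the left-continuous inverse of the running
  maximum, so that \<open>dM\<close> is the image of Lebesgue measure under \<open>y \<mapsto> \<tau>\<^bsub>X \<ge> y\<^esub>\<close>, and \<open>X = M = y\<close> at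
  that time. As \<open>f(y) dy\<close> is the law of \<open>Y\<close>, the payoff of the \<open>(X, M)\<close> problem is the conditional
  expectation given \<open>X\<close> of the payoff of the problem with \<open>Y\<close>, restricted to \<open>Y > m \<or> X\<^sub>0\<close>; the event
  \<open>Y \<le> x\<close>, on which the hitting time is \<open>0\<close>, contributes \<open>F(x) G(x)\<close>. Fubini's theorem applies because
  both discounted rewards are dominated by the integrable suprema in (A1) and (A4). Finally,
  \<open>M\<close> is adapted to the filtration of \<open>X\<close>, so both problems have the same stopping times.\<close>

section \<open>Hitting times and the running maximum along one continuous path\<close>

lemma bdd_above_path:
  fixes \<omega> :: "real \<Rightarrow> real"
  assumes "continuous_on {0..} \<omega>"
  shows "bdd_above (\<omega> ` {0..t})"
proof -
  have "compact (\<omega> ` {0..t})"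
    by (intro compact_continuous_image continuous_on_subset[OF assms]) auto
  then show ?thesis
    by (simp add: bounded_imp_bdd_above compact_imp_bounded)
qed

text \<open>The set of times at which the path is at or above \<open>y\<close> is closed by
  continuity and nonempty because \<open>hit\<close> is finite, so the infimum is attained.\<close>

lemma hit_finiteE:
  assumes "continuous_on {0..} \<omega>" and "hit \<omega> y < \<infinity>"
  obtains s where "0 \<le> s" "hit \<omega> y = ennreal s" "y \<le> \<omega> s" "\<And>u. 0 \<le> u \<Longrightarrow> u < s \<Longrightarrow> \<omega> u < y"
proof -
  define A where "A = {t \<in> {0..}. y \<le> \<omega> t}"
  have A_alt: "{t. 0 \<le> t \<and> y \<le> \<omega> t} = A"
    by (auto simp: A_def)
  have "closed A"
    unfolding A_def by (intro continuous_on_closed_Collect_le assms continuous_on_const closed_atLeast)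
  moreover have "A \<noteq> {}"
    using assms(2) unfolding hit_def A_alt by auto
  moreover have bdd: "bdd_below A"
    by (auto simp: A_def)
  ultimately have mem: "Inf A \<in> A"
    by (intro closed_contains_Inf)
  have le: "Inf A \<le> u" if "u \<in> A" for u
    using bdd that by (rule cInf_lower[rotated])
  have "hit \<omega> y = ennreal (Inf A)"
    unfolding hit_def A_alt using mem le
    by (intro antisym INF_lower INF_greatest ennreal_leI) auto
  moreover have "\<omega> u < y" if "0 \<le> u" "u < Inf A" for u
    using le[of u] that by (force simp: A_def)
  ultimately show ?thesis
    using mem by (intro that[of "Inf A"]) (auto simp: A_def)
qed

text \<open>This duality between passage times and the maximum uses attainment on both sides: the
  infimum defining \<open>hit\<close> is attained on a closed set, the supremum on the compact
  interval \<open>{0..t}\<close>.\<close>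

lemma hit_le_iff:
  assumes "continuous_on {0..} \<omega>" and "0 \<le> t"
  shows "hit \<omega> y \<le> ennreal t \<longleftrightarrow> y \<le> (SUP s\<in>{0..t}. \<omega> s)"
proof
  assume le: "hit \<omega> y \<le> ennreal t"
  then have "hit \<omega> y < \<infinity>"
    by (simp add: order_le_less_trans)
  then obtain s where "0 \<le> s" "hit \<omega> y = ennreal s" "y \<le> \<omega> s"
    using hit_finiteE[OF assms(1)] by metis
  moreover from this le have "s \<in> {0..t}"
    using assms(2) by auto
  ultimately show "y \<le> (SUP s\<in>{0..t}. \<omega> s)"
    using bdd_above_path[OF assms(1)] by (meson cSUP_upper2)
next
  assume le: "y \<le> (SUP s\<in>{0..t}. \<omega> s)"
  have "\<exists>s\<in>{0..t}. \<forall>u\<in>{0..t}. \<omega> u \<le> \<omega> s"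
    using assms by (intro continuous_attains_sup continuous_on_subset[OF assms(1)]) auto
  then obtain s where s: "s \<in> {0..t}" "\<And>u. u \<in> {0..t} \<Longrightarrow> \<omega> u \<le> \<omega> s"
    by auto
  then have "(SUP s\<in>{0..t}. \<omega> s) \<le> \<omega> s"
    by (intro cSUP_least) auto
  with le s show "hit \<omega> y \<le> ennreal t"
    unfolding hit_def by (intro INF_lower2[of s] ennreal_leI) auto
qed

lemma run_max_0: "run_max m \<omega> 0 = max m (\<omega> 0)"
  by (simp add: run_max_def)

text \<open>For levels above the starting value of the maximum, the floor \<open>m\<close> does not
  interfere with the duality. Negative \<open>t\<close> is covered as well, since
  \<open>ennreal t\<close> is then 0; this matches the extension of the path by a constant in
  \<open>dM\<close>.\<close>

lemma hit_le_iff_run_max: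
  assumes "continuous_on {0..} \<omega>" and "max m (\<omega> 0) < y"
  shows "hit \<omega> y \<le> ennreal t \<longleftrightarrow> y \<le> run_max m \<omega> (max 0 t)"
proof -
  have "hit \<omega> y \<le> ennreal (max 0 t) \<longleftrightarrow> y \<le> (SUP s\<in>{0..max 0 t}. \<omega> s)"
    by (intro hit_le_iff assms) simp
  moreover have "ennreal (max 0 t) = ennreal t"
    by (simp add: max_def ennreal_neg)
  ultimately show ?thesis
    using assms(2) by (auto simp: run_max_def le_max_iff_disj)
qed

lemma run_max_mono:
  assumes "continuous_on {0..} \<omega>" and "0 \<le> s" "s \<le> t"
  shows "run_max m \<omega> s \<le> run_max m \<omega> t"
  unfolding run_max_def
  by (intro max.mono order_refl cSUP_subset_mono bdd_above_path assms) (use assms in auto)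

text \<open>A continuous path that starts strictly below \<open>y\<close> cannot jump over
  \<open>y\<close>. It therefore sits exactly at \<open>y\<close> when it first reaches it, and it
  has stayed below \<open>y\<close> until then, so the maximum equals \<open>y\<close> too.\<close>

lemma hit_run_max:
  assumes "continuous_on {0..} \<omega>" and "max m (\<omega> 0) < y" and "hit \<omega> y < \<infinity>"
  obtains s where "0 < s" "hit \<omega> y = ennreal s" "\<omega> s = y" "run_max m \<omega> s = y"
proof -
  obtain s where s: "0 \<le> s" "hit \<omega> y = ennreal s" "y \<le> \<omega> s" "\<And>u. 0 \<le> u \<Longrightarrow> u < s \<Longrightarrow> \<omega> u < y"
    using hit_finiteE[OF assms(1,3)] by metis
  have "s \<noteq> 0"
    using s(3) assms(2) by auto
  have "\<omega> s = y"
  proof (rule ccontr)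
    assume "\<omega> s \<noteq> y"
    \<comment> \<open>An overshoot at \<open>s\<close> would force an earlier crossing of
      \<open>y\<close>, against the minimality of \<open>s\<close>.\<close>
    have "\<exists>u\<ge>0. u \<le> s \<and> \<omega> u = y"
      using s assms(2) by (intro IVT' continuous_on_subset[OF assms(1)]) auto
    then obtain u where u: "0 \<le> u" "u \<le> s" "\<omega> u = y"
      by auto
    with \<open>\<omega> s \<noteq> y\<close> have "u < s"
      by (cases "u = s") auto
    with s(4) u show False
      by fastforce
  qed
  moreover have "\<omega> u \<le> y" if "u \<in> {0..s}" for u
    using s(4)[of u] that \<open>\<omega> s = y\<close> by (cases "u = s") auto
  then have "(SUP u\<in>{0..s}. \<omega> u) = y"
    using \<open>\<omega> s = y\<close> s(1) by (intro cSup_eq_maximum) auto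
  ultimately show ?thesis
    using s \<open>s \<noteq> 0\<close> assms(2) by (intro that[of s]) (auto simp: run_max_def)
qed

text \<open>Right continuity and monotonicity are what \<open>interval_measure\<close> requires of
  its distribution function. A jump of size at least \<open>e\<close> just after \<open>a\<close>
  would make the level \<open>y\<close>, lying \<open>e\<close> above the maximum at
  \<open>a\<close>, be reached before every \<open>a + d\<close>; as the hitting time is then at
  most \<open>a\<close>, the maximum at \<open>a\<close> would already be at least
  \<open>y\<close>.\<close>

lemma run_max_continuous_at_right:
  assumes "continuous_on {0..} \<omega>"
  shows "continuous (at_right a) (\<lambda>t. run_max m \<omega> (max 0 t))"
proof (subst continuous_at_right_real_increasing, goal_cases)
  case (1 x y)
  then show ?case
    by (intro run_max_mono assms) auto
next
  case 2
  show ?case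
  proof (intro allI impI)
    fix e :: real
    assume "0 < e"
    define y where "y = run_max m \<omega> (max 0 a) + e"
    have "run_max m \<omega> 0 \<le> run_max m \<omega> (max 0 a)"
      by (intro run_max_mono assms) auto
    with \<open>0 < e\<close> have y: "max m (\<omega> 0) < y"
      by (simp add: y_def run_max_0)
    show "\<exists>d>0. run_max m \<omega> (max 0 (a + d)) - run_max m \<omega> (max 0 a) < e"
    proof (rule ccontr)
      assume "\<not> ?thesis"
      then have le: "hit \<omega> y \<le> ennreal (a + d)" if "0 < d" for d
        using that by (subst hit_le_iff_run_max[OF assms y]) (auto simp: y_def algebra_simps)
      have "hit \<omega> y < \<infinity>"
        using le[of 1] by (simp add: order_le_less_trans)
      then obtain s where s: "0 < s" "hit \<omega> y = ennreal s"
        using hit_run_max[OF assms y] by metis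
      have "s \<le> a + d" if "0 < d" for d
        using le[OF that] s by (cases "0 \<le> a + d") (auto simp: ennreal_neg)
      then have "s \<le> a"
        by (rule field_le_epsilon)
      then have "hit \<omega> y \<le> ennreal a"
        using s by (auto intro: ennreal_leI)
      then show False
        using \<open>0 < e\<close> by (subst (asm) hit_le_iff_run_max[OF assms y]) (auto simp: y_def)
    qed
  qed
qed

section \<open>The measure \<open>dM\<close> as an image of Lebesgue measure\<close>

text \<open>Both measures give a half-open interval \<open>{a<..b}\<close> the increment of the
  maximum over it, and such intervals generate the Borel sets. The restriction removes levels
  reached at time 0, which carry no increment, and levels never reached, which
  \<open>enn2real\<close> would wrongly send to time 0.\<close>

lemma dM_eq_distr_hit:
  assumes cont: "continuous_on {0..} \<omega>" and [measurable]: "hit \<omega> \<in> borel_measurable borel"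
  shows "dM m \<omega> = distr (restrict_space lborel {y. max m (\<omega> 0) < y \<and> hit \<omega> y < \<infinity>}) borel
    (\<lambda>y. enn2real (hit \<omega> y))"
    (is "_ = distr (restrict_space lborel ?D) borel ?h")
proof (rule measure_eqI_generator_eq_countable)
  let ?F = "\<lambda>t. run_max m \<omega> (max 0 t)"
  let ?E = "range (\<lambda>(a, b). {a<..b::real})"
  have mono: "?F s \<le> ?F t" if "s \<le> t" for s t
    using that by (intro run_max_mono cont) auto
  have D: "?D \<in> sets borel"
    by measurable
  have h: "?h \<in> borel_measurable (restrict_space lborel ?D)"
    by (intro measurable_restrict_space1) measurable
  show "Int_stable ?E"
    by (force simp: Int_stable_def)
  show "?E \<subseteq> Pow UNIV"
    by auto
  show "sets (dM m \<omega>) = sigma_sets UNIV ?E" "sets (distr (restrict_space lborel ?D) borel ?h) = sigma_sets UNIV ?E"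
    by (simp_all add: dM_def borel_sigma_sets_Ioc)
  have dM_Ioc: "emeasure (dM m \<omega>) {a<..b} = ennreal (?F b - ?F a)" if "a \<le> b" for a b
    unfolding dM_def using that mono run_max_continuous_at_right[OF cont]
    by (intro emeasure_interval_measure_Ioc) auto
  show "emeasure (dM m \<omega>) X = emeasure (distr (restrict_space lborel ?D) borel ?h) X" if "X \<in> ?E" for X
  proof -
    from that obtain a b where X: "X = {a<..b}"
      by auto
    show ?thesis
    proof (cases "a \<le> b")
      case True
      \<comment> \<open>The levels first reached during \<open>{a<..b}\<close> are those that the
        maximum passes between \<open>a\<close> and \<open>b\<close>; such levels lie in
        \<open>?D\<close> automatically.\<close>
      have eq: "?h -` {a<..b} \<inter> ?D = {?F a<..?F b}"
      proof (intro set_eqI)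
        fix y
        show "y \<in> ?h -` {a<..b} \<inter> ?D \<longleftrightarrow> y \<in> {?F a<..?F b}"
        proof (cases "y \<in> ?D")
          case True
          then obtain s where s: "0 < s" "hit \<omega> y = ennreal s"
            using hit_run_max[OF cont] by blast
          have "s \<le> t \<longleftrightarrow> y \<le> ?F t" for t
            using hit_le_iff_run_max[OF cont, of m y t] True s
            by (cases "0 \<le> t") (auto simp: ennreal_neg)
          from this[of a] this[of b] True s show ?thesis
            by auto
        next
          case False
          have "y \<notin> {?F a<..?F b}"
          proof
            assume y: "y \<in> {?F a<..?F b}"
            have "run_max m \<omega> 0 \<le> ?F a"
              by (intro run_max_mono cont) auto
            with y have "max m (\<omega> 0) < y"
              by (simp add: run_max_0)
            moreover from this y have "hit \<omega> y \<le> ennreal b"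
              by (subst hit_le_iff_run_max[OF cont]) auto
            then have "hit \<omega> y < \<infinity>"
              by (simp add: order_le_less_trans)
            ultimately show False
              using False by auto
          qed
          with False show ?thesis
            by auto
        qed
      qed
      have "emeasure (distr (restrict_space lborel ?D) borel ?h) {a<..b} =
          emeasure (restrict_space lborel ?D) (?h -` {a<..b} \<inter> ?D)"
        using h by (subst emeasure_distr) (auto simp: space_restrict_space)
      also have "\<dots> = emeasure lborel (?h -` {a<..b} \<inter> ?D)"
        using D by (intro emeasure_restrict_space) auto
      finally have "emeasure (distr (restrict_space lborel ?D) borel ?h) {a<..b} = emeasure lborel {?F a<..?F b}"
        unfolding eq .
      then show ?thesis
        using True mono[of a b] by (simp add: X dM_Ioc)
    qed (simp add: X)
  qed
  show "range (\<lambda>n. {- real n<..real n}) \<subseteq> ?E"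
    by auto
  show "\<Union> (range (\<lambda>n. {- real n<..real n})) = UNIV"
  proof (intro equalityI subsetI UNIV_I)
    fix x :: real
    obtain n where "\<bar>x\<bar> < real n"
      using reals_Archimedean2 by blast
    then show "x \<in> \<Union> (range (\<lambda>n. {- real n<..real n}))"
      by (intro UN_I[of n]) auto
  qed
  show "countable (range (\<lambda>n. {- real n<..real n}))"
    by simp
  show "emeasure (dM m \<omega>) a \<noteq> \<infinity>" if "a \<in> range (\<lambda>n. {- real n<..real n})" for a
    using that by (auto simp: dM_Ioc)
qed

section \<open>Rational time grids, filtrations and measurability on path space\<close>

text \<open>Rounding down keeps the grid points at or before \<open>s\<close>. This matters for
  adaptedness, where no time after \<open>s\<close> may be inspected; that the grid is countable
  serves evaluation of a path at a random time.\<close>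

lemma tendsto_floor_grid: "(\<lambda>n. real_of_int \<lfloor>real (Suc n) * s\<rfloor> / real (Suc n)) \<longlonglongrightarrow> s"
proof (rule real_tendsto_sandwich)
  show "(\<lambda>n. s - 1 / real (Suc n)) \<longlonglongrightarrow> s"
    using tendsto_diff[OF tendsto_const LIMSEQ_inverse_real_of_nat, of s] by (simp add: divide_inverse)
  show "eventually (\<lambda>n. s - 1 / real (Suc n) \<le> real_of_int \<lfloor>real (Suc n) * s\<rfloor> / real (Suc n)) sequentially"
  proof (intro always_eventually allI)
    fix n
    have "(real (Suc n) * s - 1) / real (Suc n) \<le> real_of_int \<lfloor>real (Suc n) * s\<rfloor> / real (Suc n)"
      by (intro divide_right_mono) linarith+
    then show "s - 1 / real (Suc n) \<le> real_of_int \<lfloor>real (Suc n) * s\<rfloor> / real (Suc n)"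
      by (simp add: diff_divide_distrib del: of_nat_Suc)
  qed
  show "eventually (\<lambda>n. real_of_int \<lfloor>real (Suc n) * s\<rfloor> / real (Suc n) \<le> s) sequentially"
  proof (intro always_eventually allI)
    fix n
    have "real_of_int \<lfloor>real (Suc n) * s\<rfloor> \<le> real (Suc n) * s"
      by linarith
    then show "real_of_int \<lfloor>real (Suc n) * s\<rfloor> / real (Suc n) \<le> s"
      by (simp add: field_simps del: of_nat_Suc)
  qed
qed auto

lemma floor_grid_bounds:
  assumes "0 \<le> s"
  shows "0 \<le> real_of_int \<lfloor>real (Suc n) * s\<rfloor> / real (Suc n)"
    and "real_of_int \<lfloor>real (Suc n) * s\<rfloor> / real (Suc n) \<le> s"
proof -
  show "0 \<le> real_of_int \<lfloor>real (Suc n) * s\<rfloor> / real (Suc n)"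
    using assms by (intro divide_nonneg_nonneg) auto
  have "real_of_int \<lfloor>real (Suc n) * s\<rfloor> \<le> real (Suc n) * s"
    by linarith
  then show "real_of_int \<lfloor>real (Suc n) * s\<rfloor> / real (Suc n) \<le> s"
    by (simp add: field_simps del: of_nat_Suc)
qed

lemma tendsto_path_floor_grid:
  fixes \<omega> :: "real \<Rightarrow> real"
  assumes "continuous_on {0..} \<omega>" and "0 \<le> s"
  shows "(\<lambda>n. \<omega> (real_of_int \<lfloor>real (Suc n) * s\<rfloor> / real (Suc n))) \<longlonglongrightarrow> \<omega> s"
  using assms floor_grid_bounds[OF assms(2)]
  by (intro continuous_on_tendsto_compose[OF assms(1) tendsto_floor_grid]) auto

lemma paths_continuous: "\<omega> \<in> paths I \<Longrightarrow> continuous_on {0..} \<omega>"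
  by (simp add: paths_def)

lemma paths_mem: "\<omega> \<in> paths I \<Longrightarrow> 0 \<le> t \<Longrightarrow> \<omega> t \<in> I"
  by (auto simp: paths_def PiE_def Pi_def)

lemma space_generated_filtration [simp]: "space (generated_filtration \<Omega> Z t) = \<Omega>"
  unfolding generated_filtration_def by (rule space_measure_of) auto

lemma sets_generated_filtration:
  "sets (generated_filtration \<Omega> Z t) =
    sigma_sets \<Omega> {Z s -` B \<inter> \<Omega> |s B. 0 \<le> s \<and> ennreal s \<le> t \<and> B \<in> sets borel}"
  unfolding generated_filtration_def by (rule sets_measure_of) auto

lemma measurable_generated_filtration:
  "0 \<le> s \<Longrightarrow> ennreal s \<le> t \<Longrightarrow> Z s \<in> borel_measurable (generated_filtration \<Omega> Z t)"
  by (intro measurableI) (auto simp: sets_generated_filtration)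

lemma generated_filtration_eqI:
  assumes "\<And>s. 0 \<le> s \<Longrightarrow> ennreal s \<le> t \<Longrightarrow> Z s \<in> borel_measurable (generated_filtration \<Omega> Z' t)"
    and "\<And>s. 0 \<le> s \<Longrightarrow> ennreal s \<le> t \<Longrightarrow> Z' s \<in> borel_measurable (generated_filtration \<Omega> Z t)"
  shows "generated_filtration \<Omega> Z t = generated_filtration \<Omega> Z' t"
proof -
  have sub: "sets (generated_filtration \<Omega> Y t) \<subseteq> sets (generated_filtration \<Omega> Y' t)"
    if "\<And>s. 0 \<le> s \<Longrightarrow> ennreal s \<le> t \<Longrightarrow> Y s \<in> borel_measurable (generated_filtration \<Omega> Y' t)"
    for Y :: "real \<Rightarrow> 'a \<Rightarrow> 'd::topological_space" and Y' :: "real \<Rightarrow> 'a \<Rightarrow> 'e::topological_space"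
  proof -
    have "{Y s -` B \<inter> \<Omega> |s B. 0 \<le> s \<and> ennreal s \<le> t \<and> B \<in> sets borel} \<subseteq> sets (generated_filtration \<Omega> Y' t)"
      using measurable_sets[OF that] by auto
    from sets.sigma_sets_subset[OF this] show ?thesis
      by (simp add: sets_generated_filtration[of \<Omega> Y])
  qed
  have "sets (generated_filtration \<Omega> Z t) = sets (generated_filtration \<Omega> Z' t)"
    using sub[of Z Z'] sub[of Z' Z] assms by blast
  \<comment> \<open>\<open>sigma\<close> yields the zero measure, so equal sigma-algebras already
    make the two measures equal.\<close>
  then show ?thesis
    by (intro measure_eqI) (auto simp: generated_filtration_def emeasure_sigma)
qed

lemma sets_right_cont_filtration:
  "sets (right_cont_filtration \<Omega> Z t) \<subseteq> sets (generated_filtration \<Omega> Z \<infinity>)"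
  "space (right_cont_filtration \<Omega> Z t) = \<Omega>"
proof -
  have sub: "(\<Inter>u\<in>{u. t < u \<or> u = \<infinity>}. sets (generated_filtration \<Omega> Z u)) \<subseteq> sets (generated_filtration \<Omega> Z \<infinity>)"
    by (rule INT_lower) simp
  then have pow: "(\<Inter>u\<in>{u. t < u \<or> u = \<infinity>}. sets (generated_filtration \<Omega> Z u)) \<subseteq> Pow \<Omega>"
    using sets.space_closed[of "generated_filtration \<Omega> Z \<infinity>"] by simp
  show "sets (right_cont_filtration \<Omega> Z t) \<subseteq> sets (generated_filtration \<Omega> Z \<infinity>)"
    unfolding right_cont_filtration_def sets_measure_of[OF pow]
    using sets.sigma_sets_subset[OF sub] by simp
  show "space (right_cont_filtration \<Omega> Z t) = \<Omega>"
    unfolding right_cont_filtration_def by (rule space_measure_of[OF pow])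
qed

abbreviation path_filtration :: "real set \<Rightarrow> ennreal \<Rightarrow> (real \<Rightarrow> real) measure" where
  "path_filtration I \<equiv> generated_filtration (paths I) (\<lambda>t \<omega>. \<omega> t)"

text \<open>Continuity lets rational times decide an upper bound on the whole interval.
  Approximation from below keeps these times inside \<open>{0..t}\<close>.\<close>

lemma SUP_path_le_iff:
  fixes \<omega> :: "real \<Rightarrow> real"
  assumes "continuous_on {0..} \<omega>" and "0 \<le> t"
  shows "(SUP s\<in>{0..t}. \<omega> s) \<le> a \<longleftrightarrow> (\<forall>q\<in>\<rat> \<inter> {0..t}. \<omega> q \<le> a)"
proof
  assume "(SUP s\<in>{0..t}. \<omega> s) \<le> a"
  then show "\<forall>q\<in>\<rat> \<inter> {0..t}. \<omega> q \<le> a"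
    using cSUP_upper[OF _ bdd_above_path[OF assms(1)], of _ t] by fastforce
next
  assume le: "\<forall>q\<in>\<rat> \<inter> {0..t}. \<omega> q \<le> a"
  show "(SUP s\<in>{0..t}. \<omega> s) \<le> a"
  proof (rule cSUP_least)
    fix s
    assume s: "s \<in> {0..t}"
    let ?q = "\<lambda>n. real_of_int \<lfloor>real (Suc n) * s\<rfloor> / real (Suc n)"
    have "\<omega> (?q n) \<le> a" for n
    proof -
      have "?q n \<in> \<rat>"
        by (intro Rats_divide Rats_of_int Rats_of_nat)
      moreover have "?q n \<in> {0..t}"
        using floor_grid_bounds[of s n] s by auto
      ultimately show ?thesis
        using le by blast
    qed
    then show "\<omega> s \<le> a"
      using s by (intro LIMSEQ_le_const2[OF tendsto_path_floor_grid[OF assms(1)]]) auto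
  qed (use assms in auto)
qed

text \<open>The sublevel sets are countable intersections over rational times up to
  \<open>s\<close>, so the supremum is adapted and not merely measurable on path space.\<close>

lemma borel_measurable_SUP_path:
  assumes "0 \<le> s" "ennreal s \<le> t"
  shows "(\<lambda>\<omega>. SUP u\<in>{0..s}. \<omega> u) \<in> borel_measurable (path_filtration I t)"
proof (rule borel_measurableI_le)
  fix a
  have [measurable]: "(\<lambda>\<omega>. \<omega> q) \<in> borel_measurable (path_filtration I t)" if "q \<in> \<rat> \<inter> {0..s}" for q
    using that assms by (intro measurable_generated_filtration) (auto intro: order_trans ennreal_leI)
  have "{\<omega> \<in> space (path_filtration I t). (SUP u\<in>{0..s}. \<omega> u) \<le> a} =
      {\<omega> \<in> space (path_filtration I t). \<forall>q\<in>\<rat> \<inter> {0..s}. \<omega> q \<le> a}"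
    using assms SUP_path_le_iff[OF paths_continuous] by auto
  also have "\<dots> \<in> sets (path_filtration I t)"
    by (intro sets.sets_Collect_countable_All' countable_Int1 countable_rat) measurable
  finally show "{\<omega> \<in> space (path_filtration I t). (SUP u\<in>{0..s}. \<omega> u) \<le> a} \<in> sets (path_filtration I t)" .
qed

text \<open>The maximum up to time \<open>s\<close> is a functional of the path up to
  \<open>s\<close>, and the path is the first coordinate of the pair. Hence each process is adapted
  to the filtration of the other.\<close>

lemma generated_filtration_XM:
  "generated_filtration (paths I) (\<lambda>t \<omega>. (\<omega> t, run_max m \<omega> t)) u = path_filtration I u"
proof (rule generated_filtration_eqI)
  fix s
  assume s: "0 \<le> s" "ennreal s \<le> u"
  have [measurable]: "(\<lambda>\<omega>. \<omega> s) \<in> borel_measurable (path_filtration I u)"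
    using s by (rule measurable_generated_filtration)
  have [measurable]: "(\<lambda>\<omega>. SUP u\<in>{0..s}. \<omega> u) \<in> borel_measurable (path_filtration I u)"
    using s by (rule borel_measurable_SUP_path)
  show "(\<lambda>\<omega>. (\<omega> s, run_max m \<omega> s)) \<in> borel_measurable (path_filtration I u)"
    unfolding run_max_def by measurable
  have "(\<lambda>\<omega>. fst (\<omega> s, run_max m \<omega> s)) \<in>
      borel_measurable (generated_filtration (paths I) (\<lambda>t \<omega>. (\<omega> t, run_max m \<omega> t)) u)"
    by (rule measurable_compose[OF measurable_generated_filtration[OF s] borel_measurable_continuous_onI])
      (intro continuous_intros)
  then show "(\<lambda>\<omega>. \<omega> s) \<in>
      borel_measurable (generated_filtration (paths I) (\<lambda>t \<omega>. (\<omega> t, run_max m \<omega> t)) u)"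
    by simp
qed

lemma stopping_times_XM_eq: "stopping_times_XM I m = stopping_times_X I"
proof -
  have "right_cont_filtration (paths I) (\<lambda>t \<omega>. (\<omega> t, run_max m \<omega> t)) = right_cont_filtration (paths I) (\<lambda>t \<omega>. \<omega> t)"
    by (intro ext) (simp add: right_cont_filtration_def generated_filtration_XM)
  then show ?thesis
    by (simp add: stopping_times_XM_def stopping_times_X_def)
qed

lemma space_path_space [simp]: "space (path_space I) = paths I"
  by (simp add: path_space_def)

lemma measurable_path_coordinate:
  "0 \<le> t \<Longrightarrow> (\<lambda>\<omega>. \<omega> t) \<in> borel_measurable (path_space I)"
  unfolding path_space_def by (rule measurable_generated_filtration) auto

lemma borel_measurable_stopping_time:
  assumes "\<tau> \<in> stopping_times_X I"
  shows "\<tau> \<in> borel_measurable (path_space I)"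
  using assms unfolding stopping_times_X_def path_space_def
  by (intro measurable_stopping_time[where F = "right_cont_filtration (paths I) (\<lambda>t \<omega>. \<omega> t)"])
    (auto simp: sets_right_cont_filtration(2) dest: subsetD[OF sets_right_cont_filtration(1)])

text \<open>Joint measurability, as Fubini requires, follows from the duality: for finite
  \<open>t\<close> the sublevel set is \<open>y \<le> (SUP s\<in>{0..t}. \<omega> s)\<close>, a
  comparison of two measurable functions.\<close>

lemma borel_measurable_hit:
  "(\<lambda>(\<omega>, y). hit \<omega> y) \<in> borel_measurable (path_space I \<Otimes>\<^sub>M borel)"
proof (rule borel_measurableI_le)
  fix u :: ennreal
  show "{p \<in> space (path_space I \<Otimes>\<^sub>M borel). (case p of (\<omega>, y) \<Rightarrow> hit \<omega> y) \<le> u} \<in> sets (path_space I \<Otimes>\<^sub>M borel)"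
  proof (cases u)
    case (real t)
    have [measurable]: "(\<lambda>\<omega>. SUP s\<in>{0..t}. \<omega> s) \<in> borel_measurable (path_space I)"
      unfolding path_space_def using real(1) by (intro borel_measurable_SUP_path) auto
    have "{p \<in> space (path_space I \<Otimes>\<^sub>M borel). (case p of (\<omega>, y) \<Rightarrow> hit \<omega> y) \<le> u} =
        {p \<in> space (path_space I \<Otimes>\<^sub>M borel). snd p \<le> (SUP s\<in>{0..t}. fst p s)}"
      using hit_le_iff[OF paths_continuous real(1)] real(2) by (auto simp: space_pair_measure)
    also have "\<dots> \<in> sets (path_space I \<Otimes>\<^sub>M borel)"
      by measurable
    finally show ?thesis .
  qed simp
qed

lemma borel_measurable_hit_section:
  "\<omega> \<in> paths I \<Longrightarrow> hit \<omega> \<in> borel_measurable borel"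
  using measurable_compose_Pair1[OF _ borel_measurable_hit, of \<omega> I] by simp

text \<open>Rounding \<open>T\<close> down to a grid leaves countably many times, at each of which
  evaluation is a coordinate map; path continuity then gives the limit. Nonnegativity of
  \<open>T\<close> ensures that \<open>nat\<close> does not alter the floor.\<close>

lemma borel_measurable_path_eval:
  assumes "w \<in> measurable K (path_space I)" and [measurable]: "T \<in> borel_measurable K"
    and "\<And>k. k \<in> space K \<Longrightarrow> 0 \<le> T k"
  shows "(\<lambda>k. w k (T k)) \<in> borel_measurable K"
proof (rule borel_measurable_LIMSEQ_real)
  fix n
  let ?q = "\<lambda>i :: nat. real i / real (Suc n)"
  have "(\<lambda>k. w k (?q i)) \<in> borel_measurable K" for i
    by (rule measurable_compose[OF assms(1) measurable_path_coordinate]) simp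
  then have "(\<lambda>k. w k (?q (nat \<lfloor>real (Suc n) * T k\<rfloor>))) \<in> borel_measurable K"
    by (rule measurable_compose_countable) measurable
  then show "(\<lambda>k. w k (real (nat \<lfloor>real (Suc n) * T k\<rfloor>) / real (Suc n))) \<in> borel_measurable K" .
next
  fix k
  assume k: "k \<in> space K"
  have "continuous_on {0..} (w k)"
    using measurable_space[OF assms(1) k] by (auto intro: paths_continuous)
  from tendsto_path_floor_grid[OF this assms(3)[OF k]]
  show "(\<lambda>n. w k (real (nat \<lfloor>real (Suc n) * T k\<rfloor>) / real (Suc n))) \<longlonglongrightarrow> w k (T k)"
    using assms(3)[OF k] by (simp add: of_nat_nat del: of_nat_Suc)
qed

text \<open>The reward is controlled on \<open>I\<close> only, so measurability is asked of its
  product with \<open>indicator I\<close>. Paths stay in \<open>I\<close>, hence the indicator can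
  be inserted without changing the value.\<close>

lemma borel_measurable_discounted:
  assumes w: "w \<in> measurable K (path_space I)" and T [measurable]: "T \<in> borel_measurable K"
    and g [measurable]: "(\<lambda>y. indicator I y * g y :: real) \<in> borel_measurable borel"
  shows "(\<lambda>k. discounted r g (w k) (T k)) \<in> borel_measurable K"
proof -
  have [measurable]: "(\<lambda>k. w k (enn2real (T k))) \<in> borel_measurable K"
    by (rule borel_measurable_path_eval[OF w]) auto
  have [measurable]: "(\<lambda>k. indicator I (w k (enn2real (T k))) * g (w k (enn2real (T k)))) \<in> borel_measurable K"
    using measurable_compose[OF \<open>(\<lambda>k. w k (enn2real (T k))) \<in> borel_measurable K\<close> g] .
  have eq: "discounted r g (w k) (T k) = (if T k = \<infinity> then 0 else exp (- r * enn2real (T k)) *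
      (indicator I (w k (enn2real (T k))) * g (w k (enn2real (T k)))))" if "k \<in> space K" for k
    using measurable_space[OF w that] by (simp add: discounted_def paths_mem)
  show ?thesis
    by (subst measurable_cong[OF eq]) (assumption, measurable)
qed

lemma discounted_le_SUP:
  "ennreal \<bar>discounted r g \<omega> T\<bar> \<le> (SUP t\<in>{0..}. ennreal (exp (- r * t) * \<bar>g (\<omega> t)\<bar>))"
proof (cases "T = \<infinity>")
  case False
  then have "ennreal \<bar>discounted r g \<omega> T\<bar> = ennreal (exp (- r * enn2real T) * \<bar>g (\<omega> (enn2real T))\<bar>)"
    by (simp add: discounted_def abs_mult)
  also have "\<dots> \<le> (SUP t\<in>{0..}. ennreal (exp (- r * t) * \<bar>g (\<omega> t)\<bar>))"
    by (rule SUP_upper) simp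
  finally show ?thesis .
qed (simp add: discounted_def)

text \<open>All three facts are transported from a weak solution along the map sending a sample
  point to its path.\<close>

lemma diffusion_lawD:
  assumes "diffusion_law I \<mu> \<sigma> x P"
  shows "prob_space P" "sets P = sets (path_space I)" "AE \<omega> in P. \<omega> 0 = x"
proof -
  obtain N :: "((real \<Rightarrow> real) \<times> (real \<Rightarrow> real)) measure" and \<FF> Z W
    where sol: "weak_solution I \<mu> \<sigma> x N \<FF> Z W"
      and P: "P = distr N (path_space I) (\<lambda>\<omega>. \<lambda>t\<in>{0..}. Z t \<omega>)"
    using assms unfolding diffusion_law_def by blast
  interpret prob_space N
    using sol by (simp add: weak_solution_def)
  have Z: "Z t \<in> borel_measurable N" if "0 \<le> t" for t
    using sol that unfolding weak_solution_def by (meson measurable_from_subalg)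
  \<comment> \<open>The path space is generated by coordinate preimages, so measurability reduces to
    that of each \<open>Z s\<close>.\<close>
  have meas: "(\<lambda>\<omega>. \<lambda>t\<in>{0..}. Z t \<omega>) \<in> measurable N (path_space I)"
    unfolding path_space_def generated_filtration_def
  proof (rule measurable_measure_of)
    show maps: "(\<lambda>\<omega>. \<lambda>t\<in>{0..}. Z t \<omega>) \<in> space N \<rightarrow> paths I"
    proof
      fix \<omega>
      assume "\<omega> \<in> space N"
      with sol have "continuous_on {0..} (\<lambda>t. Z t \<omega>)" "\<forall>t\<ge>0. Z t \<omega> \<in> I"
        by (auto simp: weak_solution_def)
      moreover from this(1) have "continuous_on {0..} (\<lambda>t\<in>{0..}. Z t \<omega>)"
        by (rule continuous_on_eq) simp
      ultimately show "(\<lambda>t\<in>{0..}. Z t \<omega>) \<in> paths I"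
        by (auto simp: paths_def)
    qed
    fix A :: "(real \<Rightarrow> real) set"
    assume "A \<in> {(\<lambda>\<omega>. \<omega> s) -` B \<inter> paths I |s B. 0 \<le> s \<and> ennreal s \<le> \<infinity> \<and> B \<in> sets borel}"
    then obtain s B where A: "A = (\<lambda>\<omega>. \<omega> s) -` B \<inter> paths I" and "0 \<le> s" "B \<in> sets borel"
      by blast
    have "(\<lambda>\<omega>. \<lambda>t\<in>{0..}. Z t \<omega>) -` A \<inter> space N = Z s -` B \<inter> space N"
      using maps \<open>0 \<le> s\<close> by (auto simp: A)
    then show "(\<lambda>\<omega>. \<lambda>t\<in>{0..}. Z t \<omega>) -` A \<inter> space N \<in> sets N"
      using measurable_sets[OF Z[OF \<open>0 \<le> s\<close>] \<open>B \<in> sets borel\<close>] by simp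
  qed auto
  show "prob_space P"
    unfolding P by (rule prob_space_distr[OF meas])
  show "sets P = sets (path_space I)"
    by (simp add: P)
  have [measurable]: "(\<lambda>\<omega>. \<omega> 0) \<in> borel_measurable (path_space I)"
    by (rule measurable_path_coordinate) simp
  have start: "{\<omega> \<in> space (path_space I). \<omega> 0 = x} \<in> sets (path_space I)"
    by measurable
  have "AE \<omega> in N. Z 0 \<omega> = x"
    using sol by (simp add: weak_solution_def)
  then show "AE \<omega> in P. \<omega> 0 = x"
    unfolding P by (subst AE_distr_iff[OF meas start]) simp
qed

text \<open>The maximum is either its starting value or a level that the path attains at a hitting
  time, and both lie in \<open>I\<close>.\<close>

lemma run_max_mem:
  assumes "\<omega> \<in> paths I" "m \<in> I" "0 \<le> t"
  shows "run_max m \<omega> t \<in> I"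
proof (cases "max m (\<omega> 0) < run_max m \<omega> t")
  case True
  note cont = paths_continuous[OF assms(1)]
  have "hit \<omega> (run_max m \<omega> t) \<le> ennreal t"
    using assms(3) by (simp add: hit_le_iff_run_max[OF cont True])
  then have "hit \<omega> (run_max m \<omega> t) < \<infinity>"
    by (simp add: order_le_less_trans)
  then obtain s where "0 < s" "\<omega> s = run_max m \<omega> t"
    using hit_run_max[OF cont True] by metis
  then show ?thesis
    using paths_mem[OF assms(1), of s] by simp
next
  case False
  moreover have "run_max m \<omega> 0 \<le> run_max m \<omega> t"
    using assms by (intro run_max_mono paths_continuous) auto
  ultimately have "run_max m \<omega> t = max m (\<omega> 0)"
    unfolding run_max_0 by linarith
  then show ?thesis
    using assms(2) paths_mem[OF assms(1), of 0] by (auto simp: max_def)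
qed

section \<open>The payoff of the maximum problem as an integral over \<open>Y\<close> along a fixed
  path\<close>

context
  fixes I :: "real set" and f G :: "real \<Rightarrow> real" and Q :: "real measure"
  assumes f_meas [measurable]: "(\<lambda>y. indicator I y * f y) \<in> borel_measurable borel"
    and G_meas [measurable]: "(\<lambda>y. indicator I y * G y) \<in> borel_measurable borel"
    and f_nonneg: "\<forall>y\<in>I. 0 \<le> f y"
    and Q_density: "Q = density lborel (\<lambda>y. ennreal (f y) * indicator I y)"
begin

text \<open>This is the change of variables from time \<open>t\<close> to level \<open>y\<close>
  with \<open>t = hit \<omega> y\<close>. There path and maximum both equal \<open>y\<close>, so the
  factor \<open>f\<close> turns Lebesgue measure into \<open>Q\<close> and leaves the discounted
  reward. The equality of integrals includes the non-integrable case, where both sides are 0 by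
  default.\<close>

lemma dM_integral_eq_hit_integral:
  fixes T :: ennreal and m r :: real
  assumes \<omega>: "\<omega> \<in> paths I" and m: "m \<in> I"
  defines "k \<equiv> \<lambda>t. exp (- r * t) * G (run_max m \<omega> t) * f (run_max m \<omega> t)"
    and "h \<equiv> \<lambda>y. of_bool (max m (\<omega> 0) < y \<and> hit \<omega> y \<le> T) * discounted r G \<omega> (hit \<omega> y)"
  shows "set_integrable (dM m \<omega>) {t. 0 \<le> t \<and> ennreal t \<le> T} k \<longleftrightarrow> integrable Q h"
    and "(LINT t:{t. 0 \<le> t \<and> ennreal t \<le> T}|dM m \<omega>. k t) = (\<integral>y. h y \<partial>Q)"
proof -
  note cont = paths_continuous[OF \<omega>]
  note [measurable] = borel_measurable_hit_section[OF \<omega>]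
  let ?D = "{y. max m (\<omega> 0) < y \<and> hit \<omega> y < \<infinity>}"
  let ?F = "\<lambda>t. run_max m \<omega> (max 0 t)"
  \<comment> \<open>A version of the integrand that is Borel on the whole line: time is clipped at
    0, and \<open>G\<close> and \<open>f\<close> are masked outside \<open>I\<close>.\<close>
  define k' where "k' t = of_bool (0 \<le> t \<and> ennreal t \<le> T) *
    (exp (- r * t) * (indicator I (?F t) * G (?F t)) * (indicator I (?F t) * f (?F t)))" for t
  have F [measurable]: "?F \<in> borel_measurable borel"
    by (intro borel_measurable_mono monoI run_max_mono[OF cont]) auto
  have k' [measurable]: "k' \<in> borel_measurable borel"
    unfolding k'_def of_bool_def
    using measurable_compose[OF F f_meas] measurable_compose[OF F G_meas] by measurable
  have k'_eq: "indicator {t. 0 \<le> t \<and> ennreal t \<le> T} t *\<^sub>R k t = k' t" for t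
    using run_max_mem[OF \<omega> m, of t] by (auto simp: k_def k'_def indicator_def)
  have "?D \<in> sets borel"
    by measurable
  then have D: "?D \<inter> space lborel \<in> sets lborel"
    by simp
  have "(\<lambda>y. ennreal (f y) * indicator I y) = (\<lambda>y. ennreal (indicator I y * f y))"
    by (rule ext) (simp add: indicator_def)
  then have dens: "Q = density lborel (\<lambda>y. ennreal (indicator I y * f y))"
    by (simp only: Q_density)
  have nonneg: "AE y in lborel. 0 \<le> indicator I y * f y"
    using f_nonneg by (intro AE_I2) (auto simp: indicator_def)
  have disc: "(\<lambda>y. discounted r G \<omega> (hit \<omega> y)) \<in> borel_measurable borel"
    by (rule borel_measurable_discounted[where w = "\<lambda>_. \<omega>" and I = I]) (use \<omega> in auto)
  have "h \<in> borel_measurable borel"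
    unfolding h_def of_bool_def using disc by measurable
  then have h: "h \<in> borel_measurable lborel"
    by simp
  have f_lborel: "(\<lambda>y. indicator I y * f y) \<in> borel_measurable lborel"
    using f_meas by simp
  have hit_meas: "(\<lambda>y. enn2real (hit \<omega> y)) \<in> borel_measurable (restrict_space lborel ?D)"
    by (intro measurable_restrict_space1)
      (simp add: measurable_compose[OF borel_measurable_hit_section[OF \<omega>]])
  have eq: "indicator ?D y *\<^sub>R k' (enn2real (hit \<omega> y)) = (indicator I y * f y) *\<^sub>R h y" for y
  proof (cases "y \<in> ?D")
    case True
    then obtain s where s: "0 < s" "hit \<omega> y = ennreal s" "\<omega> s = y" "run_max m \<omega> s = y"
      using hit_run_max[OF cont, of m y] by auto
    then have "y \<in> I"
      using paths_mem[OF \<omega>, of s] by simp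
    with s True show ?thesis
      by (simp add: k'_def h_def discounted_def)
  next
    case False
    \<comment> \<open>If \<open>T = \<infinity>\<close>, the condition
      \<open>hit \<omega> y \<le> T\<close> also holds for levels never reached; there the
      convention in \<open>discounted\<close> supplies the zero.\<close>
    then have "h y = 0"
      by (auto simp: h_def discounted_def less_top[symmetric])
    with False show ?thesis
      by simp
  qed
  note dM = dM_eq_distr_hit[OF cont borel_measurable_hit_section[OF \<omega>], of m]
  show "set_integrable (dM m \<omega>) {t. 0 \<le> t \<and> ennreal t \<le> T} k \<longleftrightarrow> integrable Q h"
    unfolding set_integrable_def k'_eq
    unfolding dM integrable_distr_eq[OF hit_meas k'] dens
    unfolding integrable_restrict_space[OF D] eq
    by (rule integrable_density[OF h f_lborel nonneg, symmetric])
  show "(LINT t:{t. 0 \<le> t \<and> ennreal t \<le> T}|dM m \<omega>. k t) = (\<integral>y. h y \<partial>Q)"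
    unfolding set_lebesgue_integral_def k'_eq
    unfolding dM integral_distr[OF hit_meas k'] dens
    unfolding integral_restrict_space[OF D] eq
    by (rule integral_density[OF h f_lborel nonneg, symmetric])
qed

text \<open>For a finite stopping time, the levels above the start and not yet reached are exactly
  those above the current maximum. Their \<open>Q\<close>-mass is the factor
  \<open>1 - cdf Q\<close> of the first term; the second term is the change of variables.\<close>

lemma XM_payoff_eq_integral:
  assumes \<omega>: "\<omega> \<in> paths I" and m: "m \<in> I" and Q: "real_distribution Q"
  shows "XM_payoff Q f r R G m \<tau> \<omega> =
    (\<integral>y. of_bool (max m (\<omega> 0) < y \<and> \<tau> \<omega> < hit \<omega> y) * discounted r R \<omega> (\<tau> \<omega>) \<partial>Q) +
    (\<integral>y. of_bool (max m (\<omega> 0) < y \<and> hit \<omega> y \<le> \<tau> \<omega>) * discounted r G \<omega> (hit \<omega> y) \<partial>Q)"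
proof -
  interpret real_distribution Q
    by fact
  have "(\<integral>y. of_bool (max m (\<omega> 0) < y \<and> \<tau> \<omega> < hit \<omega> y) * discounted r R \<omega> (\<tau> \<omega>) \<partial>Q) =
      (1 - cdf Q (run_max m \<omega> (enn2real (\<tau> \<omega>)))) * discounted r R \<omega> (\<tau> \<omega>)"
  proof (cases "\<tau> \<omega>")
    case (real t)
    have "run_max m \<omega> 0 \<le> run_max m \<omega> t"
      using \<omega> real by (intro run_max_mono paths_continuous) auto
    then have "max m (\<omega> 0) < y \<and> \<tau> \<omega> < hit \<omega> y \<longleftrightarrow> run_max m \<omega> t < y" for y
      using hit_le_iff_run_max[OF paths_continuous[OF \<omega>], of m y t] real
      by (cases "max m (\<omega> 0) < y") (auto simp: run_max_0 not_le[symmetric] simp del: max_less_iff_conj)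
    then have "(\<integral>y. of_bool (max m (\<omega> 0) < y \<and> \<tau> \<omega> < hit \<omega> y) * discounted r R \<omega> (\<tau> \<omega>) \<partial>Q) =
        (\<integral>y. indicator {run_max m \<omega> t<..} y * discounted r R \<omega> (\<tau> \<omega>) \<partial>Q)"
      by (intro Bochner_Integration.integral_cong) (auto simp: indicator_def)
    also have "\<dots> = measure Q {run_max m \<omega> t<..} * discounted r R \<omega> (\<tau> \<omega>)"
      by simp
    also have "{run_max m \<omega> t<..} = space Q - {..run_max m \<omega> t}"
      by auto
    then have "measure Q {run_max m \<omega> t<..} = 1 - cdf Q (run_max m \<omega> t)"
      unfolding cdf_def by (metis prob_compl atMost_borel events_eq_borel)
    finally show ?thesis
      using real by simp
  \<comment> \<open>For an infinite stopping time \<open>enn2real\<close> evaluates the maximum at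
    time 0, but this is harmless: \<open>discounted\<close> is 0 on both sides.\<close>
  qed (simp add: discounted_def)
  then show ?thesis
    unfolding XM_payoff_def dM_integral_eq_hit_integral(2)[OF \<omega> m] by (simp only:)
qed

end

section \<open>Integrability on the product space\<close>

text \<open>The pathwise supremum dominates the discounted reward at any random time, even one
  depending on \<open>Y\<close>, and integrating it over \<open>Y\<close> costs a factor 1. The
  general \<open>T\<close> and \<open>C\<close> cover \<open>R\<close> at the stopping time as well
  as \<open>G\<close> at the hitting time.\<close>

lemma integrable_discounted_pair:
  assumes P: "prob_space P" "sets P = sets (path_space I)"
    and Q: "prob_space Q" "(\<lambda>y. y) \<in> borel_measurable Q"
    and g: "(\<lambda>y. indicator I y * g y) \<in> borel_measurable borel"
    and C [measurable]: "Measurable.pred (P \<Otimes>\<^sub>M Q) C"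
    and T: "T \<in> borel_measurable (P \<Otimes>\<^sub>M Q)"
    and bound: "(\<integral>\<^sup>+\<omega>. (SUP t\<in>{0..}. ennreal (exp (- r * t) * \<bar>g (\<omega> t)\<bar>)) \<partial>P) < \<infinity>"
  shows "integrable (P \<Otimes>\<^sub>M Q) (\<lambda>p. of_bool (C p) * discounted r g (fst p) (T p))" (is "integrable _ ?h")
proof (rule integrableI_bounded)
  interpret P: prob_space P by fact
  interpret Q: prob_space Q by fact
  have "fst \<in> measurable (P \<Otimes>\<^sub>M Q) (path_space I)"
    using measurable_fst measurable_cong_sets[OF refl P(2)] by blast
  then have [measurable]: "(\<lambda>p. discounted r g (fst p) (T p)) \<in> borel_measurable (P \<Otimes>\<^sub>M Q)"
    using T g by (intro borel_measurable_discounted[where I = I]) auto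
  show meas [measurable]: "?h \<in> borel_measurable (P \<Otimes>\<^sub>M Q)"
    unfolding of_bool_def by measurable
  have "(\<integral>\<^sup>+p. ennreal (norm (?h p)) \<partial>(P \<Otimes>\<^sub>M Q)) = (\<integral>\<^sup>+\<omega>. \<integral>\<^sup>+y. ennreal (norm (?h (\<omega>, y))) \<partial>Q \<partial>P)"
    by (rule Q.nn_integral_fst[symmetric]) measurable
  \<comment> \<open>Monotonicity of \<open>nn_integral\<close> asks for no measurability, so the
    uncountable supremum causes no difficulty.\<close>
  also have "\<dots> \<le> (\<integral>\<^sup>+\<omega>. \<integral>\<^sup>+y. (SUP t\<in>{0..}. ennreal (exp (- r * t) * \<bar>g (\<omega> t)\<bar>)) \<partial>Q \<partial>P)"
  proof (intro nn_integral_mono)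
    fix \<omega> y
    have "ennreal (norm (?h (\<omega>, y))) \<le> ennreal \<bar>discounted r g \<omega> (T (\<omega>, y))\<bar>"
      by (intro ennreal_leI) (simp add: abs_mult)
    also have "\<dots> \<le> (SUP t\<in>{0..}. ennreal (exp (- r * t) * \<bar>g (\<omega> t)\<bar>))"
      by (rule discounted_le_SUP)
    finally show "ennreal (norm (?h (\<omega>, y))) \<le> (SUP t\<in>{0..}. ennreal (exp (- r * t) * \<bar>g (\<omega> t)\<bar>))" .
  qed
  also have "\<dots> < \<infinity>"
    using bound by (simp add: Q.emeasure_space_1)
  finally show "(\<integral>\<^sup>+p. ennreal (norm (?h p)) \<partial>(P \<Otimes>\<^sub>M Q)) < \<infinity>" .
qed

lemma borel_measurable_hit_pair:
  assumes "sets P = sets (path_space I)" "(\<lambda>y. y) \<in> borel_measurable Q"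
  shows "(\<lambda>p. hit (fst p) (snd p)) \<in> borel_measurable (P \<Otimes>\<^sub>M Q)"
proof -
  have "fst \<in> measurable (P \<Otimes>\<^sub>M Q) (path_space I)"
    using measurable_fst measurable_cong_sets[OF refl assms(1)] by blast
  then have "(\<lambda>p. (fst p, snd p)) \<in> measurable (P \<Otimes>\<^sub>M Q) (path_space I \<Otimes>\<^sub>M borel)"
    using measurable_compose[OF measurable_snd assms(2)] by (intro measurable_Pair) auto
  from measurable_compose[OF this borel_measurable_hit] show ?thesis
    by simp
qed

section \<open>Fubini for a fixed stopping time, then passage to the suprema\<close>

theorem proposition1:
  fixes \<alpha> \<beta> :: ereal and I :: "real set" and r x0 xR :: real
    and \<mu> \<sigma> R G f :: "real \<Rightarrow> real"
    and P :: "real \<Rightarrow> (real \<Rightarrow> real) measure" and Q :: "real measure"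
  assumes r: "0 < r"
    and I: "\<alpha> < \<beta>" "I = einterval \<alpha> \<beta>"
    and coeffs: "continuous_on I \<mu>" "continuous_on I \<sigma>" "\<forall>x\<in>I. 0 < \<sigma> x"
    and X: "\<forall>x\<in>I. diffusion_law I \<mu> \<sigma> x (P x)"
    and natural: "natural_left I \<mu> \<sigma>" "natural_right I \<mu> \<sigma>"
    and R_C2: "R C1_differentiable_on I" "deriv R C1_differentiable_on I"
    and A1: "\<forall>x\<in>I. (\<integral>\<^sup>+\<omega>. (SUP t\<in>{0..}. ennreal (exp (- r * t) * \<bar>R (\<omega> t)\<bar>)) \<partial>P x) < \<infinity>"
    and A2: "\<forall>x\<in>I. AE \<omega> in P x. ((\<lambda>t. exp (- r * t) * R (\<omega> t)) \<longlongrightarrow> 0) at_top"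
    and A3: "x0 \<in> I"
      "\<forall>x\<in>I. x < x0 \<longrightarrow> generator \<mu> \<sigma> R x - r * R x > 0"
      "\<forall>x\<in>I. x0 < x \<longrightarrow> generator \<mu> \<sigma> R x - r * R x < 0"
    and xR: "xR \<in> I" "x0 < xR" "{x \<in> I. V_R I P r R x = ereal (R x)} = {x \<in> I. xR \<le> x}"
    and G_C1: "G C1_differentiable_on I"
    and G_piecewise_C2: "deriv G piecewise_C1_differentiable_on I"
    and A4: "\<forall>x\<in>I. (\<integral>\<^sup>+\<omega>. (SUP t\<in>{0..}. ennreal (exp (- r * t) * G (\<omega> t))) \<partial>P x) < \<infinity>"
    and A5: "\<forall>x\<in>I. AE \<omega> in P x. ((\<lambda>t. exp (- r * t) * G (\<omega> t)) \<longlongrightarrow> 0) at_top"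
    and A6: "\<forall>x\<in>I. V_R I P r R x < ereal (G x)"
    and A7: "\<forall>x\<in>I. deriv G differentiable (at x) \<longrightarrow> generator \<mu> \<sigma> G x - r * G x \<le> 0"
    and Q: "real_distribution Q"
    and A8: "Q = density lborel (\<lambda>y. ennreal (f y) * indicator I y)"
      "\<forall>y\<in>I. 0 < f y"
      "\<forall>y\<in>I. \<exists>u>0. \<exists>L. L-lipschitz_on (ball y u \<inter> I) f"
  shows "(\<forall>x\<in>I. \<forall>m\<in>I. x \<le> m \<longrightarrow> (\<forall>\<tau>\<in>stopping_times_XM I m.
            (AE \<omega> in P x. set_integrable (dM m \<omega>) {t. 0 \<le> t \<and> ennreal t \<le> \<tau> \<omega>}
               (\<lambda>t. exp (- r * t) * G (run_max m \<omega> t) * f (run_max m \<omega> t))) \<and>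
            integrable (P x) (XM_payoff Q f r R G m \<tau>)))
         \<and> (\<forall>x\<in>I. V_bar I P Q r R G x = V_XM I P Q f r R G x x + ereal (cdf Q x * G x))"
proof -
  interpret Q: real_distribution Q
    by fact
  have "open I"
    unfolding I(2) by (rule open_einterval)
  then have [measurable]: "I \<in> sets borel"
    by simp
  have "continuous_on I R" "continuous_on I G"
    using R_C2(1) G_C1 by (auto intro: differentiable_imp_continuous_on C1_diff_imp_diff)
  moreover have "continuous_on I f"
    unfolding continuous_on_eq_continuous_at[OF \<open>open I\<close>]
  proof
    fix y
    assume "y \<in> I"
    then obtain u L where "0 < u" and "L-lipschitz_on (ball y u \<inter> I) f"
      using A8(3) by blast
    then show "isCont f y"
      using \<open>y \<in> I\<close> \<open>open I\<close> lipschitz_on_continuous_on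
      by (subst continuous_on_interior[of "ball y u \<inter> I"]) (auto simp: interior_open)
  qed
  ultimately have meas: "(\<lambda>y. indicator I y * R y) \<in> borel_measurable borel"
      "(\<lambda>y. indicator I y * G y) \<in> borel_measurable borel"
      "(\<lambda>y. indicator I y * f y) \<in> borel_measurable borel"
    using borel_measurable_continuous_on_indicator[OF \<open>I \<in> sets borel\<close>, where 'b = real, unfolded real_scaleR_def]
    by blast+
  have f_nonneg: "\<forall>y\<in>I. 0 \<le> f y"
    using A8(2) by (simp add: less_imp_le)
  note dM_integral = dM_integral_eq_hit_integral[OF meas(3,2) f_nonneg A8(1)]
  note XM_payoff_eq = XM_payoff_eq_integral[OF meas(3,2) f_nonneg A8(1) _ _ Q]
  have id_meas: "(\<lambda>y. y) \<in> borel_measurable Q"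
    by simp
  have AE_I: "AE y in Q. y \<in> I"
  proof -
    have "(\<lambda>y. ennreal (f y) * indicator I y) = (\<lambda>y. ennreal (indicator I y * f y))"
      by (rule ext) (simp add: indicator_def)
    then have "(\<lambda>y. ennreal (f y) * indicator I y) \<in> borel_measurable lborel"
      using meas(3) by simp
    then show ?thesis
      unfolding A8(1) by (subst AE_density) (auto simp: indicator_def)
  qed

  have G_pos: "0 < G x" if "x \<in> I" for x
  proof -
    \<comment> \<open>Never stopping is admissible, so \<open>V\<^sub>R \<ge> 0\<close>.\<close>
    have "(\<lambda>_. \<infinity>) \<in> stopping_times_X I"
      by (simp add: stopping_times_X_def stopping_time_const)
    then have "ereal (\<integral>\<omega>. discounted r R \<omega> \<infinity> \<partial>P x) \<le> V_R I P r R x"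
      unfolding V_R_def by (rule SUP_upper2) simp
    moreover have "V_R I P r R x < ereal (G x)"
      using A6 that by blast
    ultimately show ?thesis
      by (cases "V_R I P r R x") (auto simp: discounted_def)
  qed

  \<comment> \<open>\<open>A\<close> and \<open>B\<close> are the two summands of the payoff in
    \<open>V_bar\<close>; \<open>above\<close> cuts them down to the levels that the maximum problem
    sees.\<close>
  define A where "A \<tau> \<omega> y = of_bool (\<tau> \<omega> < hit \<omega> y) * discounted r R \<omega> (\<tau> \<omega>)" for \<tau> \<omega> y
  define B where "B \<tau> \<omega> y = of_bool (hit \<omega> y \<le> \<tau> \<omega>) * discounted r G \<omega> (hit \<omega> y)" for \<tau> \<omega> y
  define above where "above m \<omega> y = (of_bool (max m (\<omega> 0) < y) :: real)" for m y and \<omega> :: "real \<Rightarrow> real"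

  have payoff: "XM_payoff Q f r R G m \<tau> \<omega> =
      (\<integral>y. above m \<omega> y * A \<tau> \<omega> y \<partial>Q) + (\<integral>y. above m \<omega> y * B \<tau> \<omega> y \<partial>Q)"
    if "\<omega> \<in> paths I" "m \<in> I" for \<omega> m \<tau>
    using that by (simp add: XM_payoff_eq above_def A_def B_def of_bool_conj mult.assoc del: max_less_iff_conj)

  \<comment> \<open>\<open>Q'\<close> is left general because the facts are used both for
    \<open>Q\<close> on the real line and for its restriction to \<open>I\<close>.\<close>
  have joint: "integrable (P x \<Otimes>\<^sub>M Q') (\<lambda>(\<omega>, y). A \<tau> \<omega> y)"
      "integrable (P x \<Otimes>\<^sub>M Q') (\<lambda>(\<omega>, y). B \<tau> \<omega> y)"
      "integrable (P x \<Otimes>\<^sub>M Q') (\<lambda>(\<omega>, y). above m \<omega> y * A \<tau> \<omega> y)"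
      "integrable (P x \<Otimes>\<^sub>M Q') (\<lambda>(\<omega>, y). above m \<omega> y * B \<tau> \<omega> y)"
    if x: "x \<in> I" and \<tau>: "\<tau> \<in> stopping_times_X I"
      and Q': "prob_space Q'" "(\<lambda>y. y) \<in> borel_measurable Q'" for x m \<tau> Q'
  proof -
    note P = diffusion_lawD[OF X[rule_format, OF x]]
    have fst: "fst \<in> measurable (P x \<Otimes>\<^sub>M Q') (path_space I)"
      using measurable_fst measurable_cong_sets[OF refl P(2)] by blast
    have [measurable]: "(\<lambda>p. hit (fst p) (snd p)) \<in> borel_measurable (P x \<Otimes>\<^sub>M Q')"
      by (rule borel_measurable_hit_pair[OF P(2) Q'(2)])
    have [measurable]: "(\<lambda>p. \<tau> (fst p)) \<in> borel_measurable (P x \<Otimes>\<^sub>M Q')"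
      by (rule measurable_compose[OF fst borel_measurable_stopping_time[OF \<tau>]])
    have [measurable]: "(\<lambda>p. fst p 0) \<in> borel_measurable (P x \<Otimes>\<^sub>M Q')"
      by (rule measurable_compose[OF fst measurable_path_coordinate]) simp
    have [measurable]: "(\<lambda>p. snd p) \<in> borel_measurable (P x \<Otimes>\<^sub>M Q')"
      by (rule measurable_compose[OF measurable_snd Q'(2)])
    have space: "\<omega> \<in> paths I" if "\<omega> \<in> space (P x)" for \<omega>
      using that sets_eq_imp_space_eq[OF P(2)] by simp
    have bound_R: "(\<integral>\<^sup>+\<omega>. (SUP t\<in>{0..}. ennreal (exp (- r * t) * \<bar>R (\<omega> t)\<bar>)) \<partial>P x) < \<infinity>"
      using A1 x by blast
    \<comment> \<open>(A4) carries no absolute value; positivity of \<open>G\<close> on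
      \<open>I\<close> makes it a bound on the absolute value.\<close>
    have "(\<integral>\<^sup>+\<omega>. (SUP t\<in>{0..}. ennreal (exp (- r * t) * \<bar>G (\<omega> t)\<bar>)) \<partial>P x) =
        (\<integral>\<^sup>+\<omega>. (SUP t\<in>{0..}. ennreal (exp (- r * t) * G (\<omega> t))) \<partial>P x)"
    proof (intro nn_integral_cong SUP_cong refl)
      fix \<omega> and t :: real
      assume "\<omega> \<in> space (P x)" "t \<in> {0..}"
      then have "0 < G (\<omega> t)"
        by (intro G_pos paths_mem space) auto
      then show "ennreal (exp (- r * t) * \<bar>G (\<omega> t)\<bar>) = ennreal (exp (- r * t) * G (\<omega> t))"
        by simp
    qed
    then have bound_G: "(\<integral>\<^sup>+\<omega>. (SUP t\<in>{0..}. ennreal (exp (- r * t) * \<bar>G (\<omega> t)\<bar>)) \<partial>P x) < \<infinity>"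
      using A4 x by simp
    have int_R: "integrable (P x \<Otimes>\<^sub>M Q') (\<lambda>p. of_bool (C p) * discounted r R (fst p) (\<tau> (fst p)))"
      if "Measurable.pred (P x \<Otimes>\<^sub>M Q') C" for C
      by (rule integrable_discounted_pair[OF P(1,2) Q' meas(1) that _ bound_R]) measurable
    have int_G: "integrable (P x \<Otimes>\<^sub>M Q') (\<lambda>p. of_bool (C p) * discounted r G (fst p) (hit (fst p) (snd p)))"
      if "Measurable.pred (P x \<Otimes>\<^sub>M Q') C" for C
      by (rule integrable_discounted_pair[OF P(1,2) Q' meas(2) that _ bound_G]) measurable
    show "integrable (P x \<Otimes>\<^sub>M Q') (\<lambda>(\<omega>, y). A \<tau> \<omega> y)"
      unfolding A_def case_prod_beta by (rule int_R) measurable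
    show "integrable (P x \<Otimes>\<^sub>M Q') (\<lambda>(\<omega>, y). B \<tau> \<omega> y)"
      unfolding B_def case_prod_beta by (rule int_G) measurable
    show "integrable (P x \<Otimes>\<^sub>M Q') (\<lambda>(\<omega>, y). above m \<omega> y * A \<tau> \<omega> y)"
      unfolding A_def above_def case_prod_beta mult.assoc[symmetric] of_bool_conj[symmetric]
      by (rule int_R) measurable
    show "integrable (P x \<Otimes>\<^sub>M Q') (\<lambda>(\<omega>, y). above m \<omega> y * B \<tau> \<omega> y)"
      unfolding B_def above_def case_prod_beta mult.assoc[symmetric] of_bool_conj[symmetric]
      by (rule int_G) measurable
  qed

  have well_defined: "AE \<omega> in P x. set_integrable (dM m \<omega>) {t. 0 \<le> t \<and> ennreal t \<le> \<tau> \<omega>}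
          (\<lambda>t. exp (- r * t) * G (run_max m \<omega> t) * f (run_max m \<omega> t))" (is ?AE)
      "integrable (P x) (XM_payoff Q f r R G m \<tau>)" (is ?int)
    if x: "x \<in> I" and m: "m \<in> I" and \<tau>: "\<tau> \<in> stopping_times_X I" for x m \<tau>
  proof -
    note P = diffusion_lawD[OF X[rule_format, OF x]]
    have space: "\<omega> \<in> paths I" if "\<omega> \<in> space (P x)" for \<omega>
      using that sets_eq_imp_space_eq[OF P(2)] by simp
    interpret P: prob_space "P x"
      by fact
    interpret PQ: pair_sigma_finite "P x" Q ..
    note joint = joint[OF x \<tau> Q.prob_space_axioms id_meas]
    \<comment> \<open>Fubini makes almost every section integrable over \<open>Y\<close>, which by
      the change of variables is integrability against \<open>dM\<close>.\<close>
    show ?AE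
      using PQ.AE_integrable_fst[OF joint(4)[of m]] AE_space
    proof eventually_elim
      case (elim \<omega>)
      then show ?case
        using dM_integral(1)[OF space[OF elim(2)] m, where r = r and T = "\<tau> \<omega>"]
        by (simp add: above_def B_def of_bool_conj mult.assoc del: max_less_iff_conj)
    qed
    have "integrable (P x) (\<lambda>\<omega>. (\<integral>y. above m \<omega> y * A \<tau> \<omega> y \<partial>Q) + (\<integral>y. above m \<omega> y * B \<tau> \<omega> y \<partial>Q))"
      by (intro Bochner_Integration.integrable_add PQ.integrable_fst joint)
    then show ?int
      by (subst Bochner_Integration.integrable_cong[OF refl payoff[OF space m]])
  qed

  have value_eq: "(\<integral>(\<omega>, y). A \<tau> \<omega> y + B \<tau> \<omega> y \<partial>(P x \<Otimes>\<^sub>M restrict_space Q I)) =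
      (\<integral>\<omega>. XM_payoff Q f r R G x \<tau> \<omega> \<partial>P x) + cdf Q x * G x"
    if x: "x \<in> I" and \<tau>: "\<tau> \<in> stopping_times_X I" for x \<tau>
  proof -
    note P = diffusion_lawD[OF X[rule_format, OF x]]
    have space: "\<omega> \<in> paths I" if "\<omega> \<in> space (P x)" for \<omega>
      using that sets_eq_imp_space_eq[OF P(2)] by simp
    interpret P: prob_space "P x"
      by fact
    interpret QI: prob_space "restrict_space Q I"
      by (rule prob_space_restrict_space) (use AE_I in \<open>auto intro: Q.emeasure_eq_1_AE\<close>)
    interpret PQ: pair_sigma_finite "P x" Q ..
    interpret PQI: pair_sigma_finite "P x" "restrict_space Q I" ..
    note joint_Q = joint[OF x \<tau> Q.prob_space_axioms id_meas]
    note joint_QI = joint[OF x \<tau> QI.prob_space_axioms measurable_restrict_space1[OF id_meas]]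
    have int: "integrable (P x \<Otimes>\<^sub>M restrict_space Q I) (\<lambda>(\<omega>, y). A \<tau> \<omega> y + B \<tau> \<omega> y)"
      using Bochner_Integration.integrable_add[OF joint_QI(1,2)] by (simp add: case_prod_unfold)
    then have "(\<integral>(\<omega>, y). A \<tau> \<omega> y + B \<tau> \<omega> y \<partial>(P x \<Otimes>\<^sub>M restrict_space Q I)) =
        (\<integral>\<omega>. \<integral>y. A \<tau> \<omega> y + B \<tau> \<omega> y \<partial>restrict_space Q I \<partial>P x)"
      by (rule PQI.integral_fst[symmetric])
    \<comment> \<open>The inner integrals agree only almost surely: the start at \<open>x\<close>
      and the integrability of the sections both hold up to null sets.\<close>
    also have "\<dots> = (\<integral>\<omega>. XM_payoff Q f r R G x \<tau> \<omega> + cdf Q x * G x \<partial>P x)"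
    proof (rule integral_cong_AE)
      show "(\<lambda>\<omega>. \<integral>y. A \<tau> \<omega> y + B \<tau> \<omega> y \<partial>restrict_space Q I) \<in> borel_measurable (P x)"
        using PQI.integrable_fst[OF int] by simp
      show "(\<lambda>\<omega>. XM_payoff Q f r R G x \<tau> \<omega> + cdf Q x * G x) \<in> borel_measurable (P x)"
        using well_defined(2)[OF x x \<tau>] by (intro borel_measurable_add) auto
      show "AE \<omega> in P x. (\<integral>y. A \<tau> \<omega> y + B \<tau> \<omega> y \<partial>restrict_space Q I) =
          XM_payoff Q f r R G x \<tau> \<omega> + cdf Q x * G x"
        using P(3) AE_space PQ.AE_integrable_fst[OF joint_Q(1)] PQ.AE_integrable_fst[OF joint_Q(2)]
          PQ.AE_integrable_fst[OF joint_Q(3)[of x]] PQ.AE_integrable_fst[OF joint_Q(4)[of x]]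
      proof eventually_elim
        case (elim \<omega>)
        \<comment> \<open>A level \<open>y \<le> x\<close> is hit at time 0, no later than any
          stopping time, so \<open>A\<close> vanishes and \<open>B\<close> pays \<open>G x\<close>
          undiscounted.\<close>
        have split: "A \<tau> \<omega> y + B \<tau> \<omega> y =
            above x \<omega> y * A \<tau> \<omega> y + above x \<omega> y * B \<tau> \<omega> y + indicator {..x} y * G x" for y
        proof (cases "y \<le> x")
          case True
          then have "hit \<omega> y \<le> ennreal 0"
            unfolding hit_def using elim(1) by (intro INF_lower2[of 0]) auto
          then have "hit \<omega> y = 0"
            by simp
          then show ?thesis
            using True elim(1) by (simp add: A_def B_def above_def discounted_def)
        next
          case False
          then show ?thesis
            using elim(1) by (simp add: above_def)
        qed
        have below: "integrable Q (\<lambda>y. indicator {..x} y * G x)"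
          by (intro integrable_mult_left Q.integrable_const_bound[where B = 1]) auto
        \<comment> \<open>\<open>Q\<close> is concentrated on \<open>I\<close>, so the restriction
          can be lifted before the three terms of \<open>split\<close> are integrated.\<close>
        have "(\<integral>y. A \<tau> \<omega> y + B \<tau> \<omega> y \<partial>restrict_space Q I) =
            (\<integral>y. indicator I y * (A \<tau> \<omega> y + B \<tau> \<omega> y) \<partial>Q)"
          by (subst integral_restrict_space) auto
        also have "\<dots> = (\<integral>y. A \<tau> \<omega> y + B \<tau> \<omega> y \<partial>Q)"
          using AE_I elim(3,4) by (intro integral_cong_AE) auto
        also have "\<dots> = (\<integral>y. above x \<omega> y * A \<tau> \<omega> y \<partial>Q) + (\<integral>y. above x \<omega> y * B \<tau> \<omega> y \<partial>Q) +
            cdf Q x * G x"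
          unfolding split Bochner_Integration.integral_add[OF Bochner_Integration.integrable_add[OF elim(5,6)] below]
            Bochner_Integration.integral_add[OF elim(5,6)]
          by (simp add: cdf_def)
        finally show ?case
          by (simp only: payoff[OF space[OF elim(2)] x])
      qed
    qed
    also have "\<dots> = (\<integral>\<omega>. XM_payoff Q f r R G x \<tau> \<omega> \<partial>P x) + cdf Q x * G x"
      using well_defined(2)[OF x x \<tau>] by (simp add: P.prob_space)
    finally show ?thesis .
  qed

  have "V_bar I P Q r R G x = V_XM I P Q f r R G x x + ereal (cdf Q x * G x)" if x: "x \<in> I" for x
  proof -
    have "V_bar I P Q r R G x = (SUP \<tau>\<in>stopping_times_X I.
        ereal (\<integral>\<omega>. XM_payoff Q f r R G x \<tau> \<omega> \<partial>P x) + ereal (cdf Q x * G x))"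
      unfolding V_bar_def using value_eq[OF x] by (intro SUP_cong) (simp_all add: A_def B_def)
    \<comment> \<open>The added constant is finite, and constant times show that the supremum ranges
      over a nonempty set; so the constant can be pulled out.\<close>
    also have "\<dots> = V_XM I P Q f r R G x x + ereal (cdf Q x * G x)"
      unfolding V_XM_def stopping_times_XM_eq
      by (rule SUP_ereal_add_left) (auto simp: stopping_times_X_def intro: stopping_time_const)
    finally show ?thesis .
  qed
  then show ?thesis
    using well_defined by (simp add: stopping_times_XM_eq)
qed

end
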